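(* Let $\ell\ge3$, let $I$ be an ideal of $\Phi^+(D_\ell)$, and let $\mathcal{DP}(I)=(d_1,\dots,d_\ell)$ be its dual partition. Then for every odd positive integer $q$, $$\chi^{\mathrm{quasi}}_{T_I}(D_\ell,q)=\prod_{i=1}^{\ell}(q-d_i).$$
   Context: Let $\epsilon_1,\dots,\epsilon_\ell$ be an orthonormal basis of an $\ell$-dimensional Euclidean space. Type $D_\ell$ ($\ell\ge 3$): positive roots $\Phi^+(D_\ell)=\{\epsilon_i\pm\epsilon_j\ (1\le i<j\le\ell)\}$, simple roots $\alpha_i=\epsilon_i-\epsilon_{i+1}$ ($1\le i\le\ell-1$), $\alpha_\ell=\epsilon_{\ell-1}+\epsilon_\ell$. The height of $\beta=\sum_i n_i\alpha_i\in\Phi^+$ is $\mathrm{ht}(\beta)=\sum_i n_i$. On positive roots, $\beta_1\succeq\beta_2$ means that $\beta_1-\beta_2$ is a linear combination of simple roots with nonnegative integer coefficients. A subset $I\subseteq\Phi^+$ is an ideal if $\beta_1\in I$, $\beta_2\in\Phi^+$ and $\beta_1\succeq\beta_2$ imply $\beta_2\in I$. Dual partition: for an ideal $I$, let $i_k:=\#\{\beta\in I\mid\mathrm{ht}(\beta)=k\}$ for $k\ge1$ and $M:=\max\{\mathrm{ht}(\beta)\mid\beta\in I\}$. Then $\mathcal{DP}(I)$ is the sequence of $\ell$ nonnegative integers $$\left((0)^{\ell-i_1},(1)^{i_1-i_2},\dots,(M-1)^{i_{M-1}-i_M},(M)^{i_M}\right),$$ where $(a)^b$ means that $a$ is repeated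 $b$ times (for $I=\emptyset$ this is $(0)^\ell$); it is considered only up to reordering. For $\Psi\subseteq\Phi^+(D_\ell)$, $T_\Psi$ is the $\ell\times\#\Psi$ integer matrix whose columns are the coordinate vectors of the elements of $\Psi$ with respect to $\epsilon_1,\dots,\epsilon_\ell$, and for a positive integer $q$, $$\chi^{\mathrm{quasi}}_{T_\Psi}(D_\ell,q):=\#\{\mathbf z\in(\mathbb Z/q\mathbb Z)^\ell\mid\text{every entry of }\mathbf z\cdot T_\Psi\text{ is nonzero in }\mathbb Z/q\mathbb Z\}.$$ *)

theory Defs
  imports "Jordan_Normal_Form.Matrix" "HOL-Library.Multiset"
begin

(* Vectors are given by their coordinates with respect to the orthonormal basis.  All indices are
   shifted to start at 0: unit_vec l i is the basis vector epsilon_(i+1), and simple_root l i is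
   alpha_(i+1), for i < l. *)

definition pos_roots :: "nat \<Rightarrow> int vec set" where
  "pos_roots l =
     {unit_vec l i - unit_vec l j | i j. i < j \<and> j < l} \<union>
     {unit_vec l i + unit_vec l j | i j. i < j \<and> j < l}"

definition simple_root :: "nat \<Rightarrow> nat \<Rightarrow> int vec" where
  "simple_root l i =
     (if i < l - 1 then unit_vec l i - unit_vec l (i + 1)
      else unit_vec l (l - 2) + unit_vec l (l - 1))"

definition simple_comb :: "nat \<Rightarrow> (nat \<Rightarrow> nat) \<Rightarrow> int vec" where
  "simple_comb l n = vec l (\<lambda>k. \<Sum>i<l. int (n i) * simple_root l i $ k)"

(* The value is unspecified unless \<beta> is a nonnegative combination of simple roots;
   see ht_simple_comb below. *)
definition ht :: "nat \<Rightarrow> int vec \<Rightarrow> nat" where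
  "ht l \<beta> = (THE h. \<exists>n. \<beta> = simple_comb l n \<and> h = (\<Sum>i<l. n i))"

definition root_ge :: "nat \<Rightarrow> int vec \<Rightarrow> int vec \<Rightarrow> bool" where
  "root_ge l \<beta>1 \<beta>2 \<longleftrightarrow> (\<exists>n. \<beta>1 - \<beta>2 = simple_comb l n)"

definition root_ideal :: "nat \<Rightarrow> int vec set \<Rightarrow> bool" where
  "root_ideal l I \<longleftrightarrow> I \<subseteq> pos_roots l \<and>
     (\<forall>\<beta>1 \<in> I. \<forall>\<beta>2 \<in> pos_roots l. root_ge l \<beta>1 \<beta>2 \<longrightarrow> \<beta>2 \<in> I)"

definition ht_count :: "nat \<Rightarrow> int vec set \<Rightarrow> nat \<Rightarrow> nat" where
  "ht_count l I k = card {\<beta> \<in> I. ht l \<beta> = k}"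

(* The exponents are truncated differences of natural numbers; for an ideal I the sequence
   l, i_1, i_2, ... is nonincreasing, so nothing is cut off. *)
definition dual_partition :: "nat \<Rightarrow> int vec set \<Rightarrow> nat list" where
  "dual_partition l I =
     (if I = {} then replicate l 0
      else let M = Max (ht l ` I) in
        replicate (l - ht_count l I 1) 0 @
        concat (map (\<lambda>a. replicate (ht_count l I a - ht_count l I (a + 1)) a) [1..<M]) @
        replicate (ht_count l I M) M)"

(* T is the matrix whose columns are the elements of \<Psi>, each occurring once, in some order. *)
definition is_coord_mat :: "nat \<Rightarrow> int vec set \<Rightarrow> int mat \<Rightarrow> bool" where
  "is_coord_mat l \<Psi> T \<longleftrightarrow>
     T \<in> carrier_mat l (card \<Psi>) \<and> distinct (cols T) \<and> set (cols T) = \<Psi>"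

(* Elements of Z/qZ are represented by the residues 0, ..., q - 1; the row vector z * T is
   written as the transpose of T applied to z. *)
definition chi_quasi :: "int mat \<Rightarrow> nat \<Rightarrow> nat" where
  "chi_quasi T q = card {z \<in> carrier_vec (dim_row T).
     (\<forall>i < dim_row T. z $ i \<in> {0..<int q}) \<and>
     (\<forall>j < dim_col T. (transpose_mat T *\<^sub>v z) $ j mod int q \<noteq> 0)}"

lemma weighted_sum_simple_root:
  assumes "2 \<le> l" "i < l"
  shows "(\<Sum>k<l. int (l - 1 - k) * simple_root l i $ k) = 1"
proof -
  have delta: "(\<Sum>k<l. int (l - 1 - k) * unit_vec l a $ k) = int (l - 1 - a)" if "a < l" for a
  proof -
    have "(\<Sum>k<l. int (l - 1 - k) * unit_vec l a $ k) =
        (\<Sum>k<l. if k = a then int (l - 1 - k) else 0)"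
      using that by (intro sum.cong) auto
    then show ?thesis using that by simp
  qed
  show ?thesis
  proof (cases "i < l - 1")
    case True
    have "(\<Sum>k<l. int (l - 1 - k) * simple_root l i $ k) =
        (\<Sum>k<l. int (l - 1 - k) * unit_vec l i $ k) -
        (\<Sum>k<l. int (l - 1 - k) * unit_vec l (i + 1) $ k)"
      unfolding sum_subtractf[symmetric]
      using True by (intro sum.cong) (auto simp: simple_root_def right_diff_distrib)
    also have "\<dots> = int (l - 1 - i) - int (l - 1 - (i + 1))"
      using True by (simp only: delta[of i] delta[of "i + 1"])
    also have "\<dots> = 1" using True by linarith
    finally show ?thesis .
  next
    case False
    have "(\<Sum>k<l. int (l - 1 - k) * simple_root l i $ k) =
        (\<Sum>k<l. int (l - 1 - k) * unit_vec l (l - 2) $ k) +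
        (\<Sum>k<l. int (l - 1 - k) * unit_vec l (l - 1) $ k)"
      unfolding sum.distrib[symmetric]
      using False by (intro sum.cong) (auto simp: simple_root_def distrib_left)
    also have "\<dots> = int (l - 1 - (l - 2)) + int (l - 1 - (l - 1))"
      using assms by (simp only: delta[of "l - 2"] delta[of "l - 1"])
    also have "\<dots> = 1" using assms by linarith
    finally show ?thesis .
  qed
qed

lemma sum_coeffs_simple_comb:
  assumes "2 \<le> l"
  shows "(\<Sum>k<l. int (l - 1 - k) * simple_comb l n $ k) = int (\<Sum>i<l. n i)"
proof -
  have "(\<Sum>k<l. int (l - 1 - k) * simple_comb l n $ k) =
      (\<Sum>k<l. \<Sum>i<l. int (n i) * (int (l - 1 - k) * simple_root l i $ k))"
    by (intro sum.cong) (auto simp: simple_comb_def sum_distrib_left mult.left_commute)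
  also have "\<dots> = (\<Sum>i<l. int (n i) * (\<Sum>k<l. int (l - 1 - k) * simple_root l i $ k))"
    by (subst sum.swap) (simp add: sum_distrib_left)
  also have "\<dots> = (\<Sum>i<l. int (n i))"
    using weighted_sum_simple_root[OF assms] by (intro sum.cong) auto
  finally show ?thesis by simp
qed

lemma ht_simple_comb:
  assumes "2 \<le> l"
  shows "ht l (simple_comb l n) = (\<Sum>i<l. n i)"
  unfolding ht_def
proof (rule the_equality)
  fix h assume "\<exists>m. simple_comb l n = simple_comb l m \<and> h = (\<Sum>i<l. m i)"
  then obtain m where m: "simple_comb l n = simple_comb l m" "h = (\<Sum>i<l. m i)" by blast
  have "int (\<Sum>i<l. n i) = int (\<Sum>i<l. m i)"
    using sum_coeffs_simple_comb[OF assms, of n] sum_coeffs_simple_comb[OF assms, of m] m(1)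
    by simp
  then show "h = (\<Sum>i<l. n i)" using m(2) by (simp only: of_nat_eq_iff)
qed blast

lemma finite_pos_roots: "finite (pos_roots l)"
proof -
  have "pos_roots l \<subseteq> (\<lambda>(i, j). unit_vec l i - unit_vec l j) ` ({..<l} \<times> {..<l}) \<union>
      (\<lambda>(i, j). unit_vec l i + unit_vec l j) ` ({..<l} \<times> {..<l})"
    unfolding pos_roots_def by fastforce
  then show ?thesis by (rule finite_subset) auto
qed

lemma ex_coord_mat:
  assumes "\<Psi> \<subseteq> pos_roots l"
  shows "\<exists>T. is_coord_mat l \<Psi> T"
proof -
  obtain xs where xs: "set xs = \<Psi>" "distinct xs"
    using finite_distinct_list finite_subset[OF assms finite_pos_roots] by blast
  have "set xs \<subseteq> carrier_vec l" using xs(1) assms by (auto simp: pos_roots_def)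
  then have "cols (mat_of_cols l xs) = xs" by (rule cols_mat_of_cols)
  then have "is_coord_mat l \<Psi> (mat_of_cols l xs)"
    using xs distinct_card[of xs] by (auto simp: is_coord_mat_def)
  then show ?thesis ..
qed

end

theory Submission
  imports Defs
begin

text \<open>
  The coordinates of \<open>z\<close> are chosen one at a time, from the last one to the first.  Call the roots
  \<open>\<epsilon>\<^sub>i - \<epsilon>\<^sub>b\<close> and \<open>\<epsilon>\<^sub>i + \<epsilon>\<^sub>b\<close> with \<open>i < b\<close> in the ideal \<open>I\<close> its row \<open>i\<close>.  Once the later
  coordinates are fixed, row \<open>i\<close> forbids the values \<open>z\<^sub>b\<close> and \<open>- z\<^sub>b\<close>, respectively, for \<open>z\<^sub>i\<close>.  If two
  roots of row \<open>i\<close> involve different indices \<open>a\<close> and \<open>b\<close>, then one of \<open>\<epsilon>\<^sub>a \<plusminus> \<epsilon>\<^sub>b\<close> lies below one of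
  them, hence in \<open>I\<close>, and it is exactly the root that keeps the two forbidden values apart.  The only
  possible coincidence is \<open>z\<^sub>b = - z\<^sub>b\<close> when both \<open>\<epsilon>\<^sub>i - \<epsilon>\<^sub>b\<close> and \<open>\<epsilon>\<^sub>i + \<epsilon>\<^sub>b\<close> are in \<open>I\<close>; since \<open>q\<close> is odd
  this means \<open>z\<^sub>b = 0\<close>, and it happens for at most one such \<open>b\<close> (lemmas \<open>card_forbidden\<close> and
  \<open>card_with_zero\<close>).  So \<open>z\<^sub>i\<close> has \<open>q - len i\<close> possible values, or one more if a paired coordinate
  vanishes.

  It is therefore enough to know how often a given paired coordinate vanishes.  Write \<open>has_pair i\<close>
  for 1 or 0 according to whether row \<open>i\<close> contains such a pair.  The last row, \<open>l - 1\<close>, is empty.  The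
  induction in \<open>card_colourings_and_zeroed\<close> shows that all these numbers equal the product of
  \<open>q - len a + has_pair a\<close> over the other rows \<open>a\<close> already treated, whereas the number of all partial
  choices is this product times the difference of \<open>q\<close> and the number of treated rows with a pair.
  For the whole ideal the roots of the counting polynomial are thus the numbers
  \<open>len a - has_pair a\<close> for \<open>a < l - 1\<close>, together with the number of rows that contain a pair.

  That these are the entries of the dual partition is seen row by row.  A row without a pair has one
  root of each height from 1 to its length.  A row \<open>a\<close> with a pair contains both \<open>\<epsilon>\<^sub>a \<plusminus> \<epsilon>\<close> for
  the last basis vector \<open>\<epsilon>\<close>, which have the same height, so its heights are those from 1 to
  \<open>len a - 1\<close> and once more \<open>l - 1 - a\<close> (lemma \<open>row_heights\<close>).  The rows with a pair are consecutive
  and end at row \<open>l - 2\<close>, so the additional heights are 1, 2, and so on up to the number of these rows.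
  Hence the roots of height \<open>k\<close> are as many as the exponents that are at least \<open>k\<close>, and this property
  determines the dual partition (lemma \<open>mset_dual_partition\<close>).
\<close>

section \<open>Signed ideals and the heights of their rows\<close>

lemma card_singleton_filter: "card {b \<in> S. b = c} = (if c \<in> S then 1 else 0)"
  by (simp add: Collect_conv_if conj_commute)

lemma initial_segment_eq:
  fixes S :: "nat set"
  assumes "finite S" "S \<subseteq> {i<..}" and seg: "\<And>a b. \<lbrakk>b \<in> S; i < a; a < b\<rbrakk> \<Longrightarrow> a \<in> S"
  shows "S = {i<..i + card S}"
proof (cases "S = {}")
  case False
  define b where "b = Max S"
  have b: "b \<in> S" using Max_in[OF assms(1) False] by (simp add: b_def)
  have "S = {i<..b}"
    using seg[OF b] assms(2) Max_ge[OF assms(1)] b by (fastforce simp: b_def le_eq_less_or_eq)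
  moreover have "i < b" using b assms(2) by auto
  ultimately show ?thesis by simp
qed auto

text \<open>
  The combinatorial shadow of an ideal of type \<open>D\<close>: \<open>N i\<close> and \<open>P i\<close> are the sets of \<open>b > i\<close> for which
  \<open>\<epsilon>\<^sub>i - \<epsilon>\<^sub>b\<close> and \<open>\<epsilon>\<^sub>i + \<epsilon>\<^sub>b\<close> belong to the ideal.  Each closure rule states that a particular positive
  root lies below another one.  The side condition of \<open>P_N\<close> excludes the single pair of incomparable
  roots in a row, \<open>\<epsilon>\<^sub>i + \<epsilon>\<^sub>b\<close> and \<open>\<epsilon>\<^sub>i - \<epsilon>\<^sub>b\<close> for the last index \<open>b\<close>.
\<close>
locale signed_ideal =
  fixes l :: nat and N P :: "nat \<Rightarrow> nat set"
  assumes l_pos: "0 < l"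
    and N_sub: "N i \<subseteq> {i<..<l}"
    and P_sub: "P i \<subseteq> {i<..<l}"
    and N_down: "\<lbrakk>b \<in> N i; i < a; a < b\<rbrakk> \<Longrightarrow> a \<in> N i"
    and P_up: "\<lbrakk>b \<in> P i; b < c; c < l\<rbrakk> \<Longrightarrow> c \<in> P i"
    and P_N: "\<lbrakk>b \<in> P i; i < c; c < l; b \<noteq> l - 1 \<or> c \<noteq> l - 1\<rbrakk> \<Longrightarrow> c \<in> N i"
    and NN: "\<lbrakk>a \<in> N i; b \<in> N i; a < b\<rbrakk> \<Longrightarrow> b \<in> N a"
    and NP: "\<lbrakk>a \<in> N i; b \<in> P i; a < b\<rbrakk> \<Longrightarrow> b \<in> P a"
    and PN: "\<lbrakk>a \<in> N i; b \<in> P i; b < a\<rbrakk> \<Longrightarrow> a \<in> P b"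
    and PP: "\<lbrakk>a \<in> P i; b \<in> P i; a < b\<rbrakk> \<Longrightarrow> b \<in> N a"
begin

lemma last_row_empty: "N (l - 1) = {}" "P (l - 1) = {}"
proof -
  have empty: "{l - 1<..<l} = {}" by auto
  show "N (l - 1) = {}" "P (l - 1) = {}"
    using N_sub[of "l - 1"] P_sub[of "l - 1"] unfolding empty by blast+
qed

definition paired :: "nat \<Rightarrow> nat set" where "paired i = N i \<inter> P i"

definition len :: "nat \<Rightarrow> nat" where "len i = card (N i) + card (P i)"

definition has_pair :: "nat \<Rightarrow> nat" where "has_pair i = (if paired i = {} then 0 else 1)"

definition paired_rows :: "nat \<Rightarrow> nat" where "paired_rows i = card {a \<in> {i..<l - 1}. paired a \<noteq> {}}"

lemma finite_rows [simp]: "finite (N i)" "finite (P i)" "finite (paired i)"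
  using finite_subset[OF N_sub] finite_subset[OF P_sub] by (auto simp: paired_def)

text \<open>
  A pair in row \<open>i\<close> forces the whole negative half of the row, so that the paired indices are
  exactly the positive half, and the last index is always among them.
\<close>
lemma paired_nonempty:
  assumes "paired i \<noteq> {}"
  shows "N i = {i<..<l}" "paired i = P i" "l - 1 \<in> P i" "i < l - 1"
proof -
  obtain b where b: "b \<in> N i" "b \<in> P i" using assms by (auto simp: paired_def)
  have bl: "i < b" "b < l" using b N_sub[of i] by auto
  have "c \<in> N i" if "i < c" "c < l" for c
    using P_N[OF b(2) that] b(1) by (cases "b = l - 1 \<and> c = l - 1") auto
  then show N: "N i = {i<..<l}" using N_sub by fastforce
  show "paired i = P i" using N P_sub by (auto simp: paired_def)
  show "l - 1 \<in> P i" using P_up[OF b(2), of "l - 1"] b(2) bl by (cases "b = l - 1") auto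
  show "i < l - 1" using bl by linarith
qed

lemma paired_nonempty_mono:
  assumes "paired i \<noteq> {}" "i < a" "a < l - 1"
  shows "paired a \<noteq> {}"
proof -
  note paired = paired_nonempty[OF assms(1)]
  have "l - 1 \<in> N a" using NN[of a i "l - 1"] paired assms by auto
  moreover have "l - 1 \<in> P a" using NP[of a i "l - 1"] paired assms by auto
  ultimately show ?thesis by (auto simp: paired_def)
qed

lemma paired_rows_if_nonempty:
  assumes "paired i \<noteq> {}"
  shows "paired_rows i = l - 1 - i" "paired_rows (Suc i) = l - 2 - i"
proof -
  have "{a \<in> {i..<l - 1}. paired a \<noteq> {}} = {i..<l - 1}"
    using paired_nonempty_mono[OF assms] assms
    by (auto simp: le_eq_less_or_eq)
  then show "paired_rows i = l - 1 - i" by (simp add: paired_rows_def)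
  have "{a \<in> {Suc i..<l - 1}. paired a \<noteq> {}} = {Suc i..<l - 1}"
    using paired_nonempty_mono[OF assms] by auto
  then show "paired_rows (Suc i) = l - 2 - i" by (simp add: paired_rows_def)
qed

text \<open>
  Rows with a pair form a final segment of the rows before the last one, so their number tells which
  rows they are.
\<close>
lemma paired_nonempty_iff:
  assumes "a < l - 1"
  shows "paired a \<noteq> {} \<longleftrightarrow> l - 1 - a \<le> paired_rows 0"
proof
  assume *: "paired a \<noteq> {}"
  have "{a..<l - 1} \<subseteq> {a \<in> {0..<l - 1}. paired a \<noteq> {}}"
    using paired_nonempty_mono[OF *] * by (auto simp: le_eq_less_or_eq)
  from card_mono[OF _ this] show "l - 1 - a \<le> paired_rows 0" by (simp add: paired_rows_def)
next
  assume *: "l - 1 - a \<le> paired_rows 0"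
  show "paired a \<noteq> {}"
  proof
    assume "paired a = {}"
    then have "{a \<in> {0..<l - 1}. paired a \<noteq> {}} \<subseteq> {a<..<l - 1}"
      using paired_nonempty_mono[of _ a] assms by (force simp: not_less le_eq_less_or_eq)
    from card_mono[OF _ this] have "paired_rows 0 \<le> l - 1 - Suc a" by (simp add: paired_rows_def)
    with * assms show False by linarith
  qed
qed

lemma paired_rows_Suc: "i < l - 1 \<Longrightarrow> paired_rows i = paired_rows (Suc i) + has_pair i"
proof -
  assume "i < l - 1"
  then have "{a \<in> {i..<l - 1}. paired a \<noteq> {}} =
    (if paired i = {} then {} else {i}) \<union> {a \<in> {Suc i..<l - 1}. paired a \<noteq> {}}"
    by (auto simp: Suc_le_eq le_eq_less_or_eq)
  then show ?thesis by (auto simp: paired_rows_def has_pair_def)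
qed

lemma len_paired: "paired i \<noteq> {} \<Longrightarrow> len i = (l - 1 - i) + card (paired i)"
  using paired_nonempty[of i] by (simp add: len_def)

text \<open>
  \<open>P i\<close> is a final segment below \<open>l\<close>; the subtraction is exact because \<open>P i\<close> has fewer than \<open>l\<close>
  elements.
\<close>
lemma P_eq: "P i = {l - card (P i)..<l}"
proof (cases "P i = {}")
  case False
  define m where "m = Min (P i)"
  have m: "m \<in> P i" using Min_in[OF _ False] by (simp add: m_def)
  have "P i = {m..<l}"
    using P_up[OF m] P_sub[of i] Min_le[OF finite_rows(2), of _ i] m by (fastforce simp: m_def le_eq_less_or_eq)
  moreover have "m < l" using m P_sub[of i] by auto
  ultimately show ?thesis by (metis card_atLeastLessThan diff_diff_cancel less_imp_le)
qed auto

text \<open>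
  In row \<open>a\<close> the root \<open>\<epsilon>\<^sub>a - \<epsilon>\<^sub>b\<close> has height \<open>b - a\<close> and \<open>\<epsilon>\<^sub>a + \<epsilon>\<^sub>b\<close> has height \<open>2 * l - 2 - a - b\<close>.
  Along the row the heights increase in steps of one, except that \<open>l - 1 - a\<close> is the height of both
  roots with the last index.  Both of them are present precisely when the row contains a pair, and
  then one of the two is split off as the second summand.
\<close>
lemma row_heights:
  assumes "0 < k" "a < l"
  shows "card {b \<in> N a. b - a = k} + card {b \<in> P a. 2 * l - 2 - a - b = k} =
    (if k \<le> len a - has_pair a then 1 else 0) + (if paired a \<noteq> {} \<and> k = l - 1 - a then 1 else 0)"
proof -
  have "{b \<in> N a. b - a = k} = {b \<in> N a. b = a + k}" using N_sub[of a] by auto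
  then have cN: "card {b \<in> N a. b - a = k} = (if a + k \<in> N a then 1 else 0)"
    by (simp only: card_singleton_filter)
  have "{b \<in> P a. 2 * l - 2 - a - b = k} =
      {b \<in> P a. b = 2 * l - 2 - a - k \<and> k \<le> 2 * l - 2 - a}"
    using P_sub[of a] assms by auto
  also have "\<dots> = (if k \<le> 2 * l - 2 - a then {b \<in> P a. b = 2 * l - 2 - a - k} else {})"
    by simp
  finally have cP: "card {b \<in> P a. 2 * l - 2 - a - b = k} =
      (if 2 * l - 2 - a - k \<in> P a \<and> k \<le> 2 * l - 2 - a then 1 else 0)"
    by (simp only: card_singleton_filter if_distrib[of card] card.empty if_bool_eq_conj) auto
  show ?thesis
  proof (cases "paired a = {}")
    case False
    note paired = paired_nonempty[OF False]
    define p where "p = card (P a)"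
    have Pp: "P a = {l - p..<l}" using P_eq p_def by simp
    have p0: "0 < p" using paired(3) by (auto simp: p_def card_gt_0_iff)
    have "l - p \<in> P a" using p0 l_pos Pp by auto
    then have "p < l - a" using P_sub[of a] by fastforce
    moreover have "len a = (l - 1 - a) + p" using paired(1) by (simp add: len_def p_def)
    ultimately have len: "len a - has_pair a = l - 2 - a + p" and "p < l - a"
      using False p0 paired(4) by (auto simp: has_pair_def)
    \<comment> \<open>with \<open>t\<close> all truncated subtractions become sums\<close>
    obtain t where t: "l = Suc (a + p + t)"
      using \<open>p < l - a\<close> assms(2) less_imp_Suc_add[of "a + p" l] by (auto simp: less_diff_conv add.commute)
    have "a + k \<in> N a \<longleftrightarrow> k \<le> l - 1 - a" using assms paired(1) by auto
    moreover have "2 * l - 2 - a - k \<in> P a \<and> k \<le> 2 * l - 2 - a \<longleftrightarrow>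
        l - 1 - a \<le> k \<and> k \<le> l - 2 - a + p"
    proof -
      have "2 * l - 2 - a = a + 2 * p + 2 * t" "l - p = Suc (a + t)" "l - 1 - a = p + t"
        "l - 2 - a + p = 2 * p + t - 1"
        using t p0 by auto
      then show ?thesis unfolding Pp atLeastLessThan_iff using p0 t by auto
    qed
    ultimately show ?thesis
      unfolding cN cP len using False paired(4) p0 by auto
  next
    case True
    show ?thesis
    proof (cases "P a = {}")
      case True
      then have "len a = card (N a)" by (simp add: len_def)
      moreover have "N a \<subseteq> {a<..}" using N_sub[of a] by auto
      ultimately have "N a = {a<..a + len a}"
        using initial_segment_eq[OF finite_rows(1) _ N_down, of a] by simp
      then have "a + k \<in> N a \<longleftrightarrow> k \<le> len a" using assms by auto
      then show ?thesis unfolding cN cP using \<open>paired a = {}\<close> True by (simp add: has_pair_def)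
    next
      case False
      \<comment> \<open>a positive root with an earlier index would bring its partner into the row\<close>
      have "b = l - 1" if "b \<in> P a" for b
      proof (rule ccontr)
        assume "b \<noteq> l - 1"
        then have "b \<in> N a" using P_N[OF that, of b] that P_sub[of a] by auto
        with that True show False by (auto simp: paired_def)
      qed
      then have Pa: "P a = {l - 1}" using False by auto
      then have al: "a < l - 1" using P_sub[of a] by auto
      have "l - 1 \<notin> N a" using True Pa by (auto simp: paired_def)
      have Na: "N a = {a<..<l - 1}"
      proof (intro equalityI subsetI)
        fix c assume "c \<in> N a"
        then have "a < c" "c < l" "c \<noteq> l - 1" using N_sub[of a] \<open>l - 1 \<notin> N a\<close> by auto
        then show "c \<in> {a<..<l - 1}" by simp
      next
        fix c assume "c \<in> {a<..<l - 1}"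
        then show "c \<in> N a" using P_N[of "l - 1" a c] Pa by auto
      qed
      have "len a = l - 1 - a" using al by (simp add: len_def Na Pa)
      then show ?thesis unfolding cN cP unfolding Na Pa using True al assms by (auto simp: has_pair_def)
    qed
  qed
qed

end

text \<open>
  The last row is empty, so only \<open>l - 1\<close> rows contribute an exponent of their own; the number of rows
  with a pair is the remaining one.
\<close>
definition (in signed_ideal) exponents :: "nat multiset" where
  "exponents = image_mset (\<lambda>a. len a - has_pair a) (mset_set {..<l - 1}) + {#paired_rows 0#}"

lemma (in signed_ideal) size_exponents: "size exponents = l"
  using l_pos by (simp add: exponents_def)

text \<open>
  The first summand of \<open>row_heights\<close> counts the row exponents that are at least \<open>k\<close>.  The additional
  height \<open>l - 1 - a\<close> takes each value from 1 to the number of rows with a pair once, which accounts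
  for the remaining exponent.
\<close>
lemma (in signed_ideal) heights_eq_exponent_tails:
  assumes "0 < k"
  shows "(\<Sum>a<l. card {b \<in> N a. b - a = k} + card {b \<in> P a. 2 * l - 2 - a - b = k}) =
    size (filter_mset (\<lambda>x. k \<le> x) exponents)"
proof -
  have "paired_rows 0 \<le> card {0..<l - 1}" unfolding paired_rows_def by (rule card_mono) auto
  then have w0: "paired_rows 0 \<le> l - 1" by simp
  have drop_last: "(\<Sum>a<l. f a) = (\<Sum>a<l - 1. f a)" if "f (l - 1) = 0" for f :: "nat \<Rightarrow> nat"
    using that l_pos by (cases l) auto
  have "(\<Sum>a<l. card {b \<in> N a. b - a = k} + card {b \<in> P a. 2 * l - 2 - a - b = k}) =
      (\<Sum>a<l - 1. card {b \<in> N a. b - a = k} + card {b \<in> P a. 2 * l - 2 - a - b = k})"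
    by (rule drop_last) (unfold last_row_empty, simp)
  also have "\<dots> = (\<Sum>a<l - 1. (if k \<le> len a - has_pair a then 1 else 0) +
      (if paired a \<noteq> {} \<and> k = l - 1 - a then 1 else 0))"
    using row_heights[OF assms] by (intro sum.cong) auto
  also have "\<dots> = card {a \<in> {..<l - 1}. k \<le> len a - has_pair a} +
      card {a \<in> {..<l - 1}. paired a \<noteq> {} \<and> k = l - 1 - a}"
    by (simp add: sum.distrib flip: sum.inter_filter)
  also have "{a \<in> {..<l - 1}. paired a \<noteq> {} \<and> k = l - 1 - a} = (if k \<le> paired_rows 0 then {l - 1 - k} else {})"
  proof -
    have at: "paired (l - 1 - k) \<noteq> {} \<longleftrightarrow> k \<le> paired_rows 0" if "k \<le> l - 1"
      using paired_nonempty_iff[of "l - 1 - k"] that assms by simp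
    have "a < l - 1 \<and> k = l - 1 - a \<longleftrightarrow> a = l - 1 - k \<and> k \<le> l - 1" for a
      using assms by auto
    then have "{a \<in> {..<l - 1}. paired a \<noteq> {} \<and> k = l - 1 - a} =
        {a. a = l - 1 - k \<and> k \<le> l - 1 \<and> paired (l - 1 - k) \<noteq> {}}" by auto
    also have "\<dots> = (if k \<le> paired_rows 0 then {l - 1 - k} else {})"
      using at w0 by (cases "k \<le> l - 1") simp_all
    finally show ?thesis .
  qed
  finally show ?thesis
    by (simp add: exponents_def filter_mset_image_mset)
qed

section \<open>Counting signed colourings\<close>

text \<open>
  All that is used of the residues modulo an odd number is that negation is an involution whose only
  fixed point is zero, called \<open>c0\<close> here.
\<close>
locale signed_colouring = signed_ideal +
  fixes G :: "'c set" and neg :: "'c \<Rightarrow> 'c" and c0 :: 'c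
  assumes finite_G: "finite G"
    and neg_G: "x \<in> G \<Longrightarrow> neg x \<in> G"
    and neg_neg: "x \<in> G \<Longrightarrow> neg (neg x) = x"
    and neg_fixed: "x \<in> G \<Longrightarrow> neg x = x \<longleftrightarrow> x = c0"
    and c0_G: "c0 \<in> G"
begin

text \<open>
  Partial choices of the coordinates from \<open>i\<close> on that avoid all hyperplanes of the rows from \<open>i\<close> on.
\<close>
definition colourings :: "nat \<Rightarrow> (nat \<Rightarrow> 'c) set" where
  "colourings i = {z \<in> {i..<l} \<rightarrow>\<^sub>E G. \<forall>a\<in>{i..<l}.
     (\<forall>b\<in>N a. z a \<noteq> z b) \<and> (\<forall>b\<in>P a. z a \<noteq> neg (z b))}"

definition forbidden :: "nat \<Rightarrow> (nat \<Rightarrow> 'c) \<Rightarrow> 'c set" where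
  "forbidden i z = z ` N i \<union> (\<lambda>b. neg (z b)) ` P i"

lemma finite_colourings [simp]: "finite (colourings i)"
  unfolding colourings_def by (rule finite_subset[of _ "{i..<l} \<rightarrow>\<^sub>E G"]) (auto intro: finite_PiE finite_G)

lemma colouring_G: "z \<in> colourings i \<Longrightarrow> i \<le> a \<Longrightarrow> a < l \<Longrightarrow> z a \<in> G"
  by (auto simp: colourings_def)

lemma colouring_N: "z \<in> colourings i \<Longrightarrow> i \<le> a \<Longrightarrow> b \<in> N a \<Longrightarrow> z a \<noteq> z b"
  using subsetD[OF N_sub, of b a] by (simp add: colourings_def)

lemma colouring_P:
  assumes "z \<in> colourings i" "i \<le> a" "b \<in> P a"
  shows "z a \<noteq> neg (z b)" "z b \<noteq> neg (z a)"
proof -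
  have ab: "a < b" "b < l" using assms P_sub[of a] by auto
  show "z a \<noteq> neg (z b)" using assms ab by (force simp: colourings_def)
  then show "z b \<noteq> neg (z a)" using neg_neg[OF colouring_G[OF assms(1,2)]] ab by auto
qed

lemma colouring_extend_iff:
  assumes "i < l" "z \<in> colourings (Suc i)"
  shows "z(i := x) \<in> colourings i \<longleftrightarrow> x \<in> G \<and> x \<notin> forbidden i z"
proof -
  have away: "b \<noteq> i" if "i \<le> a" "b \<in> N a \<or> b \<in> P a" for a b
    using that N_sub[of a] P_sub[of a] by auto
  have ext: "z(i := x) \<in> {i..<l} \<rightarrow>\<^sub>E G \<longleftrightarrow> x \<in> G"
    using assms by (force simp: colourings_def PiE_iff extensional_def)
  have rows: "{i..<l} = insert i {Suc i..<l}" using assms(1) by auto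
  have old: "(\<forall>b\<in>N a. (z(i := x)) a \<noteq> (z(i := x)) b) \<and> (\<forall>b\<in>P a. (z(i := x)) a \<noteq> neg ((z(i := x)) b))"
    if "a \<in> {Suc i..<l}" for a
    using that assms(2) away[of a] by (auto simp: colourings_def)
  have new: "((\<forall>b\<in>N i. (z(i := x)) i \<noteq> (z(i := x)) b) \<and> (\<forall>b\<in>P i. (z(i := x)) i \<noteq> neg ((z(i := x)) b)))
     \<longleftrightarrow> x \<notin> forbidden i z"
    using away[of i] by (auto simp: forbidden_def)
  show ?thesis unfolding colourings_def mem_Collect_eq ext using old new unfolding rows by auto
qed

lemma colouring_restrict:
  assumes "i < l" "z \<in> colourings i"
  shows "z(i := undefined) \<in> colourings (Suc i)"
proof -
  have "i \<notin> N a" "i \<notin> P a" if "i \<le> a" for a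
    using that subsetD[OF N_sub, of i a] subsetD[OF P_sub, of i a] by auto
  then have "(\<forall>b\<in>N a. (z(i := undefined)) a \<noteq> (z(i := undefined)) b) \<and>
      (\<forall>b\<in>P a. (z(i := undefined)) a \<noteq> neg ((z(i := undefined)) b))" if "a \<in> {Suc i..<l}" for a
    using that assms(2) by (auto simp: colourings_def)
  moreover have "z(i := undefined) \<in> {Suc i..<l} \<rightarrow>\<^sub>E G"
    using assms(2) by (auto simp: colourings_def PiE_iff extensional_def)
  ultimately show ?thesis unfolding colourings_def by blast
qed

lemma colouring_undefined: "z \<in> colourings (Suc i) \<Longrightarrow> z i = undefined"
  by (auto simp: colourings_def PiE_iff extensional_def)

text \<open>
  A set of partial colourings is extended by one coordinate.  The set is left arbitrary since the
  colourings with a prescribed vanishing coordinate have to be extended as well.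
\<close>
lemma card_extensions:
  assumes "i < l" "S \<subseteq> colourings (Suc i)"
  shows "card {z \<in> colourings i. z(i := undefined) \<in> S} = (\<Sum>z\<in>S. card (G - forbidden i z))"
proof -
  have undef: "z i = undefined" if "z \<in> S" for z
    using that colouring_undefined assms(2) by blast
  have "bij_betw (\<lambda>(z, x). z(i := x)) (SIGMA z:S. G - forbidden i z) {z \<in> colourings i. z(i := undefined) \<in> S}"
  proof (rule bij_betw_byWitness[where f' = "\<lambda>z. (z(i := undefined), z i)"])
    show "\<forall>p\<in>SIGMA z:S. G - forbidden i z. (\<lambda>z. (z(i := undefined), z i)) ((\<lambda>(z, x). z(i := x)) p) = p"
      using undef by (auto simp: fun_upd_idem)
    show "\<forall>z\<in>{z \<in> colourings i. z(i := undefined) \<in> S}. (\<lambda>(z, x). z(i := x)) (z(i := undefined), z i) = z"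
      by auto
    show "(\<lambda>(z, x). z(i := x)) ` (SIGMA z:S. G - forbidden i z) \<subseteq> {z \<in> colourings i. z(i := undefined) \<in> S}"
      using colouring_extend_iff[OF assms(1)] assms(2) undef by (auto simp: fun_upd_idem subset_iff)
    show "(\<lambda>z. (z(i := undefined), z i)) ` {z \<in> colourings i. z(i := undefined) \<in> S} \<subseteq> (SIGMA z:S. G - forbidden i z)"
    proof (intro image_subsetI)
      fix z assume "z \<in> {z \<in> colourings i. z(i := undefined) \<in> S}"
      then have z: "z \<in> colourings i" "z(i := undefined) \<in> S" by auto
      show "(z(i := undefined), z i) \<in> (SIGMA z:S. G - forbidden i z)"
        using colouring_extend_iff[OF assms(1), of "z(i := undefined)" "z i"] z assms(2) by auto
    qed
  qed
  from bij_betw_same_card[OF this] show ?thesis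
    using card_SigmaI[of S "\<lambda>z. G - forbidden i z"] finite_subset[OF assms(2)] finite_G by simp
qed

text \<open>
  The closure rules provide, for each two roots of row \<open>i\<close> with different indices, a root of a later row
  that separates the values they forbid.  A value can thus be counted twice only if one index \<open>b\<close>
  carries both signs and \<open>z b\<close> is its own negative.
\<close>
lemma card_forbidden:
  assumes "z \<in> colourings (Suc i)"
  shows "card (forbidden i z) + (if \<exists>b\<in>paired i. z b = c0 then 1 else 0) = len i" "forbidden i z \<subseteq> G"
proof -
  have N: "Suc i \<le> b" "b < l" if "b \<in> N i" for b using that N_sub[of i] by auto
  have P: "Suc i \<le> b" "b < l" if "b \<in> P i" for b using that P_sub[of i] by auto
  show "forbidden i z \<subseteq> G" using colouring_G[OF assms] N P neg_G by (auto simp: forbidden_def)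
  have "z a \<noteq> z b" if "a \<in> N i" "b \<in> N i" "a < b" for a b
    using colouring_N[OF assms N(1) NN] that by blast
  then have injN: "inj_on z (N i)" by (auto simp: inj_on_def) (metis linorder_neqE_nat)
  have "z a \<noteq> z b" if "a \<in> P i" "b \<in> P i" "a < b" for a b
    using colouring_N[OF assms P(1) PP] that by blast
  then have "inj_on z (P i)" by (auto simp: inj_on_def) (metis linorder_neqE_nat)
  then have injP: "inj_on (\<lambda>b. neg (z b)) (P i)"
    unfolding inj_on_def using neg_neg colouring_G[OF assms] P by metis
  have diag: "a = b" if "a \<in> N i" "b \<in> P i" "z a = neg (z b)" for a b
  proof (rule ccontr)
    assume "a \<noteq> b"
    then consider "a < b" | "b < a" by linarith
    then show False
    proof cases
      case 1 then show False using colouring_P(1)[OF assms N(1) NP] that by blast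
    next
      case 2 then show False using colouring_P(2)[OF assms P(1) PN] that by blast
    qed
  qed
  have "z ` N i \<inter> (\<lambda>b. neg (z b)) ` P i = (if \<exists>b\<in>paired i. z b = c0 then {c0} else {})"
  proof -
    have "x = c0 \<and> (\<exists>b\<in>paired i. z b = c0)" if x: "x \<in> z ` N i \<inter> (\<lambda>b. neg (z b)) ` P i" for x
    proof -
      obtain a b where ab: "a \<in> N i" "b \<in> P i" "x = z a" "x = neg (z b)" using x by blast
      have "a = b" using diag ab by simp
      then have "z b = c0" using neg_fixed[OF colouring_G[OF assms N[OF ab(1)]]] ab by simp
      then show ?thesis using ab \<open>a = b\<close> by (auto simp: paired_def)
    qed
    moreover have "c0 \<in> z ` N i \<inter> (\<lambda>b. neg (z b)) ` P i" if "b \<in> paired i" "z b = c0" for b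
      using that neg_fixed[OF c0_G] by (force simp: paired_def)
    ultimately show ?thesis by auto
  qed
  then have "card (z ` N i \<inter> (\<lambda>b. neg (z b)) ` P i) = (if \<exists>b\<in>paired i. z b = c0 then 1 else 0)"
    by simp
  then show "card (forbidden i z) + (if \<exists>b\<in>paired i. z b = c0 then 1 else 0) = len i"
    using card_Un_Int[of "z ` N i" "(\<lambda>b. neg (z b)) ` P i"] card_image[OF injN] card_image[OF injP]
    by (simp add: forbidden_def len_def)
qed

definition zeroed :: "nat \<Rightarrow> nat \<Rightarrow> (nat \<Rightarrow> 'c) set" where "zeroed i b = {z \<in> colourings i. z b = c0}"

lemma card_allowed:
  assumes "z \<in> colourings (Suc i)"
  shows "int (card (G - forbidden i z)) = int (card G) - int (len i) + (if \<exists>b\<in>paired i. z b = c0 then 1 else 0)"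
proof -
  note forbidden = card_forbidden[OF assms]
  have "card (G - forbidden i z) = card G - card (forbidden i z)" "card (forbidden i z) \<le> card G"
    using forbidden(2) finite_G by (auto intro: card_Diff_subset card_mono finite_subset)
  with forbidden(1) show ?thesis by (auto split: if_splits)
qed

text \<open>
  Two paired coordinates cannot vanish simultaneously, as their difference is a root of the ideal.
\<close>
lemma card_with_zero:
  "card {z \<in> colourings (Suc i). \<exists>b\<in>paired i. z b = c0} = (\<Sum>b\<in>paired i. card (zeroed (Suc i) b))"
proof -
  have "z a \<noteq> z b" if "z \<in> colourings (Suc i)" "a \<in> paired i" "b \<in> paired i" "a < b" for z a b
    using colouring_N[OF that(1) _ NN, of a i b] that N_sub[of i] by (force simp: paired_def)
  then have "zeroed (Suc i) a \<inter> zeroed (Suc i) b = {}" if "a \<in> paired i" "b \<in> paired i" "a < b" for a b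
    using that by (force simp: zeroed_def)
  then have disj: "zeroed (Suc i) a \<inter> zeroed (Suc i) b = {}" if "a \<in> paired i" "b \<in> paired i" "a \<noteq> b" for a b
    using that by (metis Int_commute linorder_neqE_nat)
  have "{z \<in> colourings (Suc i). \<exists>b\<in>paired i. z b = c0} = (\<Union>b\<in>paired i. zeroed (Suc i) b)" by (auto simp: zeroed_def)
  then show ?thesis using disj by (simp add: card_UN_disjoint zeroed_def)
qed

lemma card_colourings_rec:
  assumes "i < l"
  shows "int (card (colourings i)) = (int (card G) - int (len i)) * int (card (colourings (Suc i)))
    + (\<Sum>b\<in>paired i. int (card (zeroed (Suc i) b)))"
proof -
  have "{z \<in> colourings i. z(i := undefined) \<in> colourings (Suc i)} = colourings i" using colouring_restrict[OF assms] by auto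
  then have "card (colourings i) = (\<Sum>z\<in>colourings (Suc i). card (G - forbidden i z))"
    using card_extensions[OF assms subset_refl] by (simp only:)
  then have "int (card (colourings i)) = (\<Sum>z\<in>colourings (Suc i). int (card (G - forbidden i z)))"
    by (simp only: of_nat_sum)
  also have "\<dots> = (\<Sum>z\<in>colourings (Suc i). int (card G) - int (len i) + (if \<exists>b\<in>paired i. z b = c0 then 1 else 0))"
    using card_allowed by (intro sum.cong) auto
  also have "\<dots> = (int (card G) - int (len i)) * int (card (colourings (Suc i)))
      + int (card {z \<in> colourings (Suc i). \<exists>b\<in>paired i. z b = c0})"
    by (simp add: sum.distrib sum.If_cases Int_def mult.commute)
  finally show ?thesis by (simp add: card_with_zero)
qed

lemma card_zeroed_rec:
  assumes "b \<in> paired i"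
  shows "int (card (zeroed i b)) = (int (card G) - int (len i) + 1) * int (card (zeroed (Suc i) b))"
proof -
  have "b \<in> N i" using assms by (simp add: paired_def)
  then have bi: "i < b" "b < l" using subsetD[OF N_sub, of b i] by simp_all
  then have il: "i < l" by simp
  have sub: "zeroed (Suc i) b \<subseteq> colourings (Suc i)" by (auto simp: zeroed_def)
  have "{z \<in> colourings i. z(i := undefined) \<in> zeroed (Suc i) b} = zeroed i b"
    using colouring_restrict[OF il] bi by (auto simp: zeroed_def)
  then have "card (zeroed i b) = (\<Sum>z\<in>zeroed (Suc i) b. card (G - forbidden i z))"
    using card_extensions[OF il sub] by (simp only:)
  then have "int (card (zeroed i b)) = (\<Sum>z\<in>zeroed (Suc i) b. int (card (G - forbidden i z)))"
    by (simp only: of_nat_sum)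
  also have "\<dots> = (\<Sum>z\<in>zeroed (Suc i) b. int (card G) - int (len i) + 1)"
    using card_allowed assms by (intro sum.cong) (auto simp: zeroed_def)
  finally show ?thesis by simp
qed

text \<open>
  If row \<open>i\<close> is complete, the coordinate \<open>i\<close> may vanish precisely if no later coordinate does.
\<close>
lemma card_zeroed_full:
  assumes "{i<..<l} \<subseteq> paired i" "i < l"
  shows "int (card (zeroed i i)) = int (card (colourings (Suc i))) - (\<Sum>b\<in>paired i. int (card (zeroed (Suc i) b)))"
proof -
  let ?S = "{z \<in> colourings (Suc i). \<not> (\<exists>b\<in>paired i. z b = c0)}"
  have eq: "paired i = {i<..<l}" "N i = {i<..<l}" "P i = {i<..<l}"
    using assms(1) N_sub[of i] P_sub[of i] unfolding paired_def by blast+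
  have negz: "neg x = c0 \<longleftrightarrow> x = c0" if "x \<in> G" for x
    using neg_neg[OF that] neg_fixed[OF c0_G] by auto
  have mem: "c0 \<in> forbidden i z \<longleftrightarrow> (\<exists>b\<in>paired i. z b = c0)" if "z \<in> colourings (Suc i)" for z
  proof -
    have "neg (z b) = c0 \<longleftrightarrow> z b = c0" if "b \<in> {i<..<l}" for b
      using negz[OF colouring_G[OF \<open>z \<in> colourings (Suc i)\<close>]] that by auto
    then show ?thesis unfolding forbidden_def eq by (auto simp: image_iff eq_commute[of c0])
  qed
  have "bij_betw (\<lambda>z. z(i := c0)) ?S (zeroed i i)"
  proof (rule bij_betw_byWitness[where f' = "\<lambda>z. z(i := undefined)"])
    show "\<forall>z\<in>?S. z(i := c0, i := undefined) = z" using colouring_undefined by (auto simp: fun_upd_idem)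
    show "\<forall>z\<in>zeroed i i. z(i := undefined, i := c0) = z" by (auto simp: zeroed_def fun_upd_idem)
    show "(\<lambda>z. z(i := c0)) ` ?S \<subseteq> zeroed i i"
      using colouring_extend_iff[OF assms(2)] mem c0_G by (auto simp: zeroed_def)
    show "(\<lambda>z. z(i := undefined)) ` zeroed i i \<subseteq> ?S"
    proof (intro image_subsetI)
      fix z assume "z \<in> zeroed i i"
      then have z: "z \<in> colourings i" "z i = c0" by (auto simp: zeroed_def)
      then have "c0 \<notin> forbidden i (z(i := undefined))"
        using colouring_extend_iff[OF assms(2) colouring_restrict[OF assms(2) z(1)], of c0]
        by (simp add: fun_upd_idem)
      then show "z(i := undefined) \<in> ?S"
        using mem[OF colouring_restrict[OF assms(2) z(1)]] colouring_restrict[OF assms(2) z(1)] by blast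
    qed
  qed
  then have "card (zeroed i i) = card ?S" by (simp add: bij_betw_same_card)
  moreover have "card (colourings (Suc i)) = card ?S + card {z \<in> colourings (Suc i). \<exists>b\<in>paired i. z b = c0}"
    by (subst card_Un_disjoint[symmetric]) (auto intro: arg_cong[where f = card])
  ultimately show ?thesis by (simp add: card_with_zero)
qed

text \<open>
  The indices whose vanishing can still matter when row \<open>i - 1\<close> is treated: by the closure rules, an
  index paired in row \<open>i - 1\<close> is paired in row \<open>i\<close> too, unless it is \<open>i\<close> itself, and then row \<open>i\<close> is
  complete.
\<close>
definition reach :: "nat \<Rightarrow> nat set" where
  "reach i = paired i \<union> (if {i<..<l} \<subseteq> paired i then {i} else {})"

lemma paired_subset_reach_Suc:
  assumes "i < l - 1" shows "paired i \<subseteq> reach (Suc i)"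
proof
  fix b assume b: "b \<in> paired i"
  then have NW: "N i = {i<..<l}" "paired i = P i" using paired_nonempty(1,2)[of i] by blast+
  have "b \<in> N i" using b by (simp add: paired_def)
  then have bl: "i < b" "b < l" using NW by auto
  have step: "c \<in> paired (Suc i)" if "c \<in> paired i" "Suc i < c" for c
  proof -
    have "c \<in> N i" "c \<in> P i" using that(1) by (auto simp: paired_def)
    moreover have "Suc i \<in> N i" using NW assms by auto
    ultimately show ?thesis using NN NP that(2) unfolding paired_def by blast
  qed
  show "b \<in> reach (Suc i)"
  proof (cases "b = Suc i")
    case False
    then show ?thesis using step[OF b] bl by (simp add: reach_def)
  next
    case True
    have "c \<in> paired (Suc i)" if "Suc i < c" "c < l" for c
      using step[of c] P_up[of b i c] b NW True that by auto
    then have "{Suc i<..<l} \<subseteq> paired (Suc i)" by auto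
    then show ?thesis by (simp add: reach_def True)
  qed
qed

definition factors :: "nat \<Rightarrow> int" where
  "factors i = (\<Prod>a = i..<l - 1. int (card G) - int (len a) + int (has_pair a))"

text \<open>
  Let \<open>f\<close> be the product for row \<open>i + 1\<close> and let \<open>r\<close>, \<open>p\<close> and \<open>w\<close> be the length of row \<open>i\<close>, the number of
  its paired indices and the number of rows with a pair from \<open>i\<close> on.  If \<open>p > 0\<close>, all rows from \<open>i\<close> to
  \<open>l - 2\<close> have a pair and the negative half of row \<open>i\<close> is complete, whence \<open>r = w + p\<close>.  The recursion
  then gives \<open>(q - r) * f * (q - w + 1) + p * f = f * (q - r + 1) * (q - w)\<close> colourings.  That the
  numbers of colourings with a vanishing coordinate do not depend on the coordinate is what makes the
  induction close up.  For the coordinate \<open>i\<close> itself, which matters only if row \<open>i\<close> is complete, one has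
  \<open>p = w\<close> and obtains \<open>f * (q - w + 1) - p * f = f * (q - r + 1)\<close> in agreement with the others.
\<close>
lemma card_colourings_and_zeroed:
  assumes "i \<le> l - 1"
  shows "int (card (colourings i)) = factors i * (int (card G) - int (paired_rows i)) \<and>
    (\<forall>b\<in>reach i. int (card (zeroed i b)) = factors i)"
  using assms
proof (induction i rule: inc_induct)
  case base
  have last: "N (l - 1) = {}" "P (l - 1) = {}" "paired (l - 1) = {}" "reach (l - 1) = {l - 1}"
  proof -
    show "N (l - 1) = {}" "P (l - 1) = {}" by (fact last_row_empty)+
    then show paired: "paired (l - 1) = {}" by (simp add: paired_def)
    have "{l - 1<..<l} = {}" by auto
    then show "reach (l - 1) = {l - 1}" unfolding reach_def paired by simp
  qed
  have range: "{l - 1..<l} = {l - 1}" using l_pos by auto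
  have "colourings (l - 1) = {l - 1} \<rightarrow>\<^sub>E G" unfolding colourings_def range using last by auto
  then have "card (colourings (l - 1)) = card G" by (simp add: card_PiE)
  moreover have "zeroed (l - 1) (l - 1) = {l - 1} \<rightarrow>\<^sub>E {c0}"
    unfolding zeroed_def \<open>colourings (l - 1) = _\<close> using c0_G
    by (auto simp: PiE_iff extensional_def restrict_def fun_eq_iff)
  then have "card (zeroed (l - 1) (l - 1)) = 1" by (simp add: card_PiE)
  moreover have "paired_rows (l - 1) = 0" "factors (l - 1) = 1" by (auto simp: paired_rows_def factors_def)
  ultimately show ?case unfolding last by simp
next
  case (step i)
  let ?q = "int (card G)"
  have il: "i < l" using step.hyps by simp
  have factors: "factors i = (?q - int (len i) + int (has_pair i)) * factors (Suc i)"
    unfolding factors_def using step.hyps by (simp add: prod.atLeast_Suc_lessThan)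
  have IH: "int (card (colourings (Suc i))) = factors (Suc i) * (?q - int (paired_rows (Suc i)))"
    and IHZ: "\<And>b. b \<in> paired i \<Longrightarrow> int (card (zeroed (Suc i) b)) = factors (Suc i)"
    using step.IH paired_subset_reach_Suc[OF step.hyps(2)] by auto
  then have sumZ: "(\<Sum>b\<in>paired i. int (card (zeroed (Suc i) b))) = int (card (paired i)) * factors (Suc i)"
    by simp
  show ?case
  proof (cases "paired i = {}")
    case True
    have "Suc i \<in> {i<..<l}" using step.hyps by simp
    then have "\<not> {i<..<l} \<subseteq> paired i" using True by blast
    then have "reach i = {}" using True by (simp add: reach_def)
    then show ?thesis
      using card_colourings_rec[OF il] True IH factors paired_rows_Suc[OF step.hyps(2)] by (simp add: has_pair_def)
  next
    case False
    have has_pair: "has_pair i = 1" using False by (simp add: has_pair_def)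
    have len: "int (len i) = int (paired_rows i) + int (card (paired i))"
      using len_paired[OF False] paired_rows_if_nonempty[OF False] by simp
    have paired_rows: "int (paired_rows i) = int (paired_rows (Suc i)) + 1"
      using paired_rows_Suc[OF step.hyps(2)] has_pair by simp
    have "int (card (colourings i)) = factors i * (?q - int (paired_rows i))"
      unfolding card_colourings_rec[OF il] sumZ IH factors has_pair len paired_rows by (simp add: algebra_simps)
    moreover have "int (card (zeroed i b)) = factors i" if "b \<in> reach i" for b
    proof (cases "b \<in> paired i")
      case True
      then show ?thesis using card_zeroed_rec[OF True] IHZ[OF True] factors has_pair by simp
    next
      case outside: False
      then have full: "{i<..<l} \<subseteq> paired i" and b: "b = i"
        using that by (auto simp: reach_def split: if_splits)
      have "paired i = {i<..<l}" using full N_sub[of i] unfolding paired_def by blast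
      then have "card (paired i) = paired_rows i" using paired_rows_if_nonempty[OF False] by simp
      then show ?thesis
        unfolding b card_zeroed_full[OF full il] sumZ IH factors has_pair len paired_rows by (simp add: algebra_simps)
    qed
    ultimately show ?thesis by blast
  qed
qed

end

lemma (in signed_colouring) card_colourings:
  "int (card (colourings 0)) = (\<Prod>x\<in>#exponents. int (card G) - int x)"
proof -
  have "has_pair a \<le> len a" for a
    using paired_nonempty(3)[of a] by (auto simp: has_pair_def len_def card_gt_0_iff Suc_le_eq)
  then have "(\<Prod>a<l - 1. int (card G) - int (len a - has_pair a)) = factors 0"
    unfolding factors_def by (intro prod.cong) (auto simp: of_nat_diff)
  then show ?thesis
    using card_colourings_and_zeroed[of 0]
    by (simp add: exponents_def image_mset.compositionality comp_def prod_unfold_prod_mset)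
qed

section \<open>Recognising the dual partition\<close>

lemma size_filter_ge_Suc:
  "size (filter_mset (\<lambda>x. k \<le> x) E) = size (filter_mset (\<lambda>x. Suc k \<le> x) E) + count E k"
  by (induction E) auto

lemma count_concat_replicate:
  "distinct xs \<Longrightarrow> count (mset (concat (map (\<lambda>a. replicate (g a) a) xs))) x =
    (if x \<in> set xs then g x else 0)"
  by (induction xs) auto

text \<open>
  A multiset of natural numbers is determined by its size and by the numbers of its entries that
  are at least \<open>k\<close>, for all positive \<open>k\<close>: the multiplicity of \<open>k\<close> is a difference of two consecutive
  ones.  In particular the height counts of \<open>I\<close> are then nonincreasing and bounded by \<open>l\<close>, so that the
  truncated subtractions in the definition of the dual partition are exact.
\<close>
lemma mset_dual_partition:
  assumes "finite I" and pos: "\<And>\<beta>. \<beta> \<in> I \<Longrightarrow> 0 < ht l \<beta>"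
    and size: "size E = l"
    and tails: "\<And>k. 0 < k \<Longrightarrow> size (filter_mset (\<lambda>x. k \<le> x) E) = ht_count l I k"
  shows "mset (dual_partition l I) = E"
proof (rule multiset_eqI)
  fix x
  have count0: "l = ht_count l I 1 + count E 0"
    using size_filter_ge_Suc[of 0 E] tails[of 1] size by simp
  have count_pos: "ht_count l I k = ht_count l I (Suc k) + count E k" if "0 < k" for k
    using size_filter_ge_Suc[of k E] tails that by simp
  show "count (mset (dual_partition l I)) x = count E x"
  proof (cases "I = {}")
    case True
    then have "ht_count l I k = 0" for k by (simp add: ht_count_def)
    then show ?thesis using True count0 count_pos[of x] by (cases "x = 0") (auto simp: dual_partition_def)
  next
    case False
    define M where "M = Max (ht l ` I)"
    have "M \<in> ht l ` I" unfolding M_def using assms(1) False by (intro Max_in) auto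
    then have M: "0 < M" using pos by auto
    have le_M: "ht l \<beta> \<le> M" if "\<beta> \<in> I" for \<beta> unfolding M_def using assms(1) that by simp
    have above: "ht_count l I k = 0" if "M < k" for k
    proof -
      have "{\<beta> \<in> I. ht l \<beta> = k} = {}" using le_M that by force
      then show ?thesis by (simp only: ht_count_def card.empty)
    qed
    have "count (mset (dual_partition l I)) x =
        (if x = 0 then l - ht_count l I 1 else 0) +
        (if x \<in> {1..<M} then ht_count l I x - ht_count l I (x + 1) else 0) +
        (if x = M then ht_count l I M else 0)"
      using False unfolding dual_partition_def M_def[symmetric] Let_def
      by (simp add: count_concat_replicate)
    then show ?thesis
      using count0 count_pos[of x] above[of x] above[of "Suc x"] M
      by (cases "x = 0"; cases "x < M"; cases "x = M") auto
  qed
qed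

section \<open>The rows of an ideal of the positive roots\<close>

definition nonneg :: "nat \<Rightarrow> int vec \<Rightarrow> bool" where
  "nonneg l v \<longleftrightarrow> (\<exists>n. v = simple_comb l n)"

lemma nonneg_add: "nonneg l u \<Longrightarrow> nonneg l v \<Longrightarrow> nonneg l (u + v)"
proof -
  have "simple_comb l m + simple_comb l n = simple_comb l (\<lambda>i. m i + n i)" for m n
    by (rule eq_vecI) (auto simp: simple_comb_def sum.distrib algebra_simps)
  then show "nonneg l u \<Longrightarrow> nonneg l v \<Longrightarrow> nonneg l (u + v)" unfolding nonneg_def by metis
qed

lemma nonneg_simple_root:
  assumes "i < l" shows "nonneg l (simple_root l i)"
proof -
  have "simple_root l i = simple_comb l (\<lambda>k. if k = i then 1 else 0)"
  proof (rule eq_vecI)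
    fix k assume "k < dim_vec (simple_comb l (\<lambda>k. if k = i then 1 else 0))"
    then have k: "k < l" by (simp add: simple_comb_def)
    have "(\<Sum>j<l. int (if j = i then 1 else 0) * simple_root l j $ k) =
        (\<Sum>j<l. if j = i then simple_root l j $ k else 0)"
      by (intro sum.cong) auto
    also have "\<dots> = simple_root l i $ k" using assms by simp
    finally show "simple_root l i $ k = simple_comb l (\<lambda>k. if k = i then 1 else 0) $ k"
      using k by (simp add: simple_comb_def)
  qed (simp add: simple_comb_def simple_root_def)
  then show ?thesis unfolding nonneg_def by blast
qed

lemma nonneg_diff:
  assumes "i \<le> j" "j < l" shows "nonneg l (unit_vec l i - unit_vec l j)"
  using assms
proof (induction j rule: dec_induct)
  case base
  have "unit_vec l i - unit_vec l i = simple_comb l (\<lambda>_. 0)"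
    by (rule eq_vecI) (auto simp: simple_comb_def)
  then show ?case unfolding nonneg_def by blast
next
  case (step j)
  have "unit_vec l i - unit_vec l (Suc j) = (unit_vec l i - unit_vec l j) + simple_root l j"
    using step by (intro eq_vecI) (auto simp: simple_root_def)
  then show ?case using nonneg_add[OF step.IH nonneg_simple_root[of j l]] step.prems by simp
qed

lemma nonneg_sum:
  assumes "i < j" "j < l" shows "nonneg l (unit_vec l i + unit_vec l j)"
proof -
  have "unit_vec l i + unit_vec l j = (unit_vec l i - unit_vec l (l - 2)) +
      (unit_vec l j - unit_vec l (l - 1)) + simple_root l (l - 1)"
    using assms by (intro eq_vecI) (auto simp: simple_root_def)
  then show ?thesis
    using nonneg_add nonneg_diff nonneg_simple_root assms by simp
qed

text \<open>
  Twice a basis vector is not a root, but it is the difference of \<open>\<epsilon>\<^sub>i + \<epsilon>\<^sub>b\<close> and \<open>\<epsilon>\<^sub>i - \<epsilon>\<^sub>b\<close>.  For the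
  last index it is not a nonnegative integer combination of simple roots.
\<close>
lemma nonneg_double:
  assumes "b < l - 1" shows "nonneg l (unit_vec l b + unit_vec l b)"
proof -
  have "unit_vec l b + unit_vec l b = (unit_vec l b - unit_vec l (l - 1)) +
      ((unit_vec l b + unit_vec l (l - 1)) :: int vec)"
    using assms by (intro eq_vecI) auto
  then show ?thesis using nonneg_add nonneg_diff nonneg_sum assms by simp
qed

text \<open>
  The height is linear: it is the pairing with the covector that takes the value 1 on every simple root.
\<close>
lemma ht_eq_weight:
  assumes "2 \<le> l" "nonneg l v"
  shows "int (ht l v) = (\<Sum>k<l. int (l - 1 - k) * v $ k)"
  using assms ht_simple_comb sum_coeffs_simple_comb unfolding nonneg_def by auto

lemma weight_unit_vec:
  "a < l \<Longrightarrow> (\<Sum>k<l. int (l - 1 - k) * unit_vec l a $ k) = int (l - 1 - a)"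
proof -
  assume "a < l"
  then have "(\<Sum>k<l. int (l - 1 - k) * unit_vec l a $ k) =
      (\<Sum>k<l. if k = a then int (l - 1 - k) else 0)"
    by (intro sum.cong) auto
  then show ?thesis using \<open>a < l\<close> by simp
qed

lemma ht_diff:
  assumes "i < j" "j < l" shows "ht l (unit_vec l i - unit_vec l j) = j - i"
proof -
  have "int (ht l (unit_vec l i - unit_vec l j)) =
      (\<Sum>k<l. int (l - 1 - k) * unit_vec l i $ k - int (l - 1 - k) * unit_vec l j $ k)"
    using assms by (subst ht_eq_weight) (auto intro!: nonneg_diff sum.cong simp: algebra_simps)
  also have "\<dots> = int (l - 1 - i) - int (l - 1 - j)"
    using assms weight_unit_vec[of i l] weight_unit_vec[of j l] by (simp only: sum_subtractf)
  finally show ?thesis using assms by linarith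
qed

lemma ht_sum:
  assumes "i < j" "j < l" shows "ht l (unit_vec l i + unit_vec l j) = 2 * l - 2 - i - j"
proof -
  have "int (ht l (unit_vec l i + unit_vec l j)) =
      (\<Sum>k<l. int (l - 1 - k) * unit_vec l i $ k + int (l - 1 - k) * unit_vec l j $ k)"
    using assms by (subst ht_eq_weight) (auto intro!: nonneg_sum sum.cong simp: algebra_simps)
  also have "\<dots> = int (l - 1 - i) + int (l - 1 - j)"
    using assms weight_unit_vec[of i l] weight_unit_vec[of j l] by (simp only: sum.distrib)
  finally show ?thesis using assms by linarith
qed

lemma root_ideal_closed:
  assumes "root_ideal l I" "\<beta> \<in> I" "\<gamma> \<in> pos_roots l" "nonneg l (\<beta> - \<gamma>)"
  shows "\<gamma> \<in> I"
  using assms unfolding root_ideal_def root_ge_def nonneg_def by blast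

definition minus_row :: "nat \<Rightarrow> int vec set \<Rightarrow> nat \<Rightarrow> nat set" where
  "minus_row l I i = {b. i < b \<and> b < l \<and> unit_vec l i - unit_vec l b \<in> I}"

definition plus_row :: "nat \<Rightarrow> int vec set \<Rightarrow> nat \<Rightarrow> nat set" where
  "plus_row l I i = {b. i < b \<and> b < l \<and> unit_vec l i + unit_vec l b \<in> I}"

lemma diff_root: "i < j \<Longrightarrow> j < l \<Longrightarrow> unit_vec l i - unit_vec l j \<in> pos_roots l"
  and sum_root: "i < j \<Longrightarrow> j < l \<Longrightarrow> unit_vec l i + unit_vec l j \<in> pos_roots l"
  unfolding pos_roots_def by blast+

text \<open>
  In each case the difference of the two roots is either \<open>\<epsilon>\<^sub>i \<plusminus> \<epsilon>\<^sub>j\<close> for some \<open>i < j\<close>, or twice a basis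
  vector.
\<close>
lemma signed_ideal_rows:
  assumes I: "root_ideal l I" and l: "0 < l"
  shows "signed_ideal l (minus_row l I) (plus_row l I)"
proof
  note closed = root_ideal_closed[OF I]
  show "0 < l" by (rule l)
  show "minus_row l I i \<subseteq> {i<..<l}" "plus_row l I i \<subseteq> {i<..<l}" for i
    by (auto simp: minus_row_def plus_row_def)
  show "a \<in> minus_row l I i" if "b \<in> minus_row l I i" "i < a" "a < b" for a b i
  proof -
    have b: "i < b" "b < l" "unit_vec l i - unit_vec l b \<in> I" using that by (auto simp: minus_row_def)
    have "unit_vec l i - unit_vec l b - (unit_vec l i - unit_vec l a) =
        (unit_vec l a - unit_vec l b :: int vec)"
      by (rule eq_vecI) auto
    then have "unit_vec l i - unit_vec l a \<in> I"
      using closed[OF b(3) diff_root] nonneg_diff[of a b l] that b by simp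
    then show ?thesis using that b by (simp add: minus_row_def)
  qed
  show "c \<in> plus_row l I i" if "b \<in> plus_row l I i" "b < c" "c < l" for b c i
  proof -
    have b: "i < b" "b < l" "unit_vec l i + unit_vec l b \<in> I" using that by (auto simp: plus_row_def)
    have "unit_vec l i + unit_vec l b - (unit_vec l i + unit_vec l c) =
        (unit_vec l b - unit_vec l c :: int vec)"
      by (rule eq_vecI) auto
    then have "unit_vec l i + unit_vec l c \<in> I"
      using closed[OF b(3) sum_root] nonneg_diff[of b c l] that b by simp
    then show ?thesis using that b by (simp add: plus_row_def)
  qed
  show "c \<in> minus_row l I i"
    if "b \<in> plus_row l I i" "i < c" "c < l" "b \<noteq> l - 1 \<or> c \<noteq> l - 1" for b c i
  proof -
    have b: "i < b" "b < l" "unit_vec l i + unit_vec l b \<in> I" using that by (auto simp: plus_row_def)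
    have eq: "unit_vec l i + unit_vec l b - (unit_vec l i - unit_vec l c) =
        (unit_vec l b + unit_vec l c :: int vec)"
      by (rule eq_vecI) auto
    have "nonneg l (unit_vec l b + unit_vec l c)"
    proof (cases b c rule: linorder_cases)
      case less then show ?thesis using nonneg_sum that by simp
    next
      case equal then show ?thesis using nonneg_double[of b l] that b by simp
    next
      case greater
      have "unit_vec l b + unit_vec l c = (unit_vec l c + unit_vec l b :: int vec)"
        by (rule eq_vecI) auto
      then show ?thesis using nonneg_sum[OF greater] b by simp
    qed
    then have "unit_vec l i - unit_vec l c \<in> I"
      using closed[OF b(3) diff_root] eq that b by simp
    then show ?thesis using that b by (simp add: minus_row_def)
  qed
  show "b \<in> minus_row l I a" if "a \<in> minus_row l I i" "b \<in> minus_row l I i" "a < b" for a b i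
  proof -
    have b: "i < a" "b < l" "unit_vec l i - unit_vec l b \<in> I" using that by (auto simp: minus_row_def)
    have "unit_vec l i - unit_vec l b - (unit_vec l a - unit_vec l b) =
        (unit_vec l i - unit_vec l a :: int vec)"
      by (rule eq_vecI) auto
    then have "unit_vec l a - unit_vec l b \<in> I"
      using closed[OF b(3) diff_root] nonneg_diff[of i a l] that b by simp
    then show ?thesis using that b by (simp add: minus_row_def)
  qed
  show "b \<in> plus_row l I a" if "a \<in> minus_row l I i" "b \<in> plus_row l I i" "a < b" for a b i
  proof -
    have b: "i < a" "b < l" "unit_vec l i + unit_vec l b \<in> I"
      using that by (auto simp: minus_row_def plus_row_def)
    have "unit_vec l i + unit_vec l b - (unit_vec l a + unit_vec l b) =
        (unit_vec l i - unit_vec l a :: int vec)"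
      by (rule eq_vecI) auto
    then have "unit_vec l a + unit_vec l b \<in> I"
      using closed[OF b(3) sum_root] nonneg_diff[of i a l] that b by simp
    then show ?thesis using that b by (simp add: plus_row_def)
  qed
  show "a \<in> plus_row l I b" if "a \<in> minus_row l I i" "b \<in> plus_row l I i" "b < a" for a b i
  proof -
    have b: "i < a" "i < b" "a < l" "unit_vec l i + unit_vec l b \<in> I"
      using that by (auto simp: minus_row_def plus_row_def)
    have "unit_vec l i + unit_vec l b - (unit_vec l b + unit_vec l a) =
        (unit_vec l i - unit_vec l a :: int vec)"
      by (rule eq_vecI) auto
    then have "unit_vec l b + unit_vec l a \<in> I"
      using closed[OF b(4) sum_root] nonneg_diff[of i a l] that b by simp
    then show ?thesis using that b by (simp add: plus_row_def)
  qed
  show "b \<in> minus_row l I a" if "a \<in> plus_row l I i" "b \<in> plus_row l I i" "a < b" for a b i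
  proof -
    have b: "i < b" "b < l" "unit_vec l i + unit_vec l a \<in> I"
      using that by (auto simp: plus_row_def)
    have "unit_vec l i + unit_vec l a - (unit_vec l a - unit_vec l b) =
        (unit_vec l i + unit_vec l b :: int vec)"
      by (rule eq_vecI) auto
    then have "unit_vec l a - unit_vec l b \<in> I"
      using closed[OF b(3) diff_root] nonneg_sum[of i b l] that b by simp
    then show ?thesis using that b by (simp add: minus_row_def)
  qed
qed

lemma Ball_root_ideal:
  assumes "I \<subseteq> pos_roots l"
  shows "(\<forall>\<beta>\<in>I. Q \<beta>) \<longleftrightarrow> (\<forall>a\<in>{0..<l}.
    (\<forall>b\<in>minus_row l I a. Q (unit_vec l a - unit_vec l b)) \<and>
    (\<forall>b\<in>plus_row l I a. Q (unit_vec l a + unit_vec l b)))"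
proof
  assume *: "\<forall>a\<in>{0..<l}.
    (\<forall>b\<in>minus_row l I a. Q (unit_vec l a - unit_vec l b)) \<and>
    (\<forall>b\<in>plus_row l I a. Q (unit_vec l a + unit_vec l b))"
  show "\<forall>\<beta>\<in>I. Q \<beta>"
  proof
    fix \<beta> assume \<beta>: "\<beta> \<in> I"
    then have "\<beta> \<in> pos_roots l" using assms by blast
    then consider i j where "i < j" "j < l" "\<beta> = unit_vec l i - unit_vec l j"
      | i j where "i < j" "j < l" "\<beta> = unit_vec l i + unit_vec l j"
      unfolding pos_roots_def by blast
    then show "Q \<beta>"
    proof cases
      case 1
      then have "j \<in> minus_row l I i" using \<beta> by (simp add: minus_row_def)
      then show ?thesis using * 1 by auto
    next
      case 2
      then have "j \<in> plus_row l I i" using \<beta> by (simp add: plus_row_def)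
      then show ?thesis using * 2 by auto
    qed
  qed
qed (auto simp: minus_row_def plus_row_def)

definition signed_root :: "nat \<Rightarrow> nat \<times> nat \<times> bool \<Rightarrow> int vec" where
  "signed_root l = (\<lambda>(a, b, s). if s then unit_vec l a + unit_vec l b else unit_vec l a - unit_vec l b)"

text \<open>
  The first nonzero coordinate of the root is at \<open>a\<close>, and the entry at \<open>b\<close> is the sign.
\<close>
lemma inj_signed_root: "inj_on (signed_root l) {(a, b, s). a < b \<and> b < l}"
proof (rule inj_onI)
  fix x y :: "nat \<times> nat \<times> bool"
  assume x: "x \<in> {(a, b, s). a < b \<and> b < l}" and y: "y \<in> {(a, b, s). a < b \<and> b < l}"
    and "signed_root l x = signed_root l y"
  moreover obtain a b s a' b' s' where xy: "x = (a, b, s)" "y = (a', b', s')"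
    by (cases x, cases y)
  ultimately have *: "a < b" "b < l" "a' < b'" "b' < l"
    and eq: "signed_root l (a, b, s) = signed_root l (a', b', s')" by auto
  have coord: "signed_root l (a, b, s) $ k =
      (if k = a then 1 else 0) + (if k = b then if s then 1 else - 1 else 0)"
    if "a < b" "b < l" "k < l" for a b s k
    using that by (auto simp: signed_root_def)
  have "a = a'"
    using arg_cong[OF eq, of "\<lambda>v. v $ a"] arg_cong[OF eq, of "\<lambda>v. v $ a'"] *
    by (auto simp: coord split: if_splits)
  moreover have "b = b' \<and> s = s'"
    using arg_cong[OF eq, of "\<lambda>v. v $ b"] * \<open>a = a'\<close>
    by (auto simp: coord split: if_splits)
  ultimately show "x = y" using xy by simp
qed

lemma ht_count_eq_sum_rows:
  assumes "I \<subseteq> pos_roots l"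
  shows "ht_count l I k = (\<Sum>a<l. card {b \<in> minus_row l I a. b - a = k} +
    card {b \<in> plus_row l I a. 2 * l - 2 - a - b = k})"
proof -
  define R where "R a = {b \<in> minus_row l I a. b - a = k} \<times> {False} \<union>
    {b \<in> plus_row l I a. 2 * l - 2 - a - b = k} \<times> {True}" for a
  have fin: "finite (minus_row l I a)" "finite (plus_row l I a)" for a
    by (auto simp: minus_row_def plus_row_def)
  have card_R: "card (R a) = card {b \<in> minus_row l I a. b - a = k} +
      card {b \<in> plus_row l I a. 2 * l - 2 - a - b = k}" for a
    unfolding R_def using fin by (subst card_Un_disjoint) (auto simp: card_cartesian_product)
  have "{\<beta> \<in> I. ht l \<beta> = k} = signed_root l ` (SIGMA a:{..<l}. R a)" (is "?L = ?R")
  proof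
    have "\<forall>\<beta>\<in>I. ht l \<beta> = k \<longrightarrow> \<beta> \<in> ?R"
      unfolding Ball_root_ideal[OF assms]
    proof (intro ballI conjI impI)
      fix a b assume "a \<in> {0..<l}" and b: "b \<in> minus_row l I a"
        and "ht l (unit_vec l a - unit_vec l b) = k"
      then have "(a, b, False) \<in> (SIGMA a:{..<l}. R a)"
        using ht_diff[of a b l] by (auto simp: R_def minus_row_def)
      then show "unit_vec l a - unit_vec l b \<in> ?R" by (force simp: signed_root_def)
    next
      fix a b assume "a \<in> {0..<l}" and b: "b \<in> plus_row l I a"
        and "ht l (unit_vec l a + unit_vec l b) = k"
      then have "(a, b, True) \<in> (SIGMA a:{..<l}. R a)"
        using ht_sum[of a b l] by (auto simp: R_def plus_row_def)
      then show "unit_vec l a + unit_vec l b \<in> ?R" by (force simp: signed_root_def)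
    qed
    then show "?L \<subseteq> ?R" by blast
    show "?R \<subseteq> ?L"
      using ht_diff[of _ _ l] ht_sum[of _ _ l]
      by (auto simp: R_def signed_root_def minus_row_def plus_row_def)
  qed
  moreover have "inj_on (signed_root l) (SIGMA a:{..<l}. R a)"
    by (rule inj_on_subset[OF inj_signed_root]) (auto simp: R_def minus_row_def plus_row_def)
  ultimately have "ht_count l I k = card (SIGMA a:{..<l}. R a)"
    by (simp add: ht_count_def card_image)
  also have "\<dots> = (\<Sum>a<l. card (R a))"
    using fin by (subst card_SigmaI) (auto simp: R_def)
  also have "\<dots> = (\<Sum>a<l. card {b \<in> minus_row l I a. b - a = k} +
    card {b \<in> plus_row l I a. 2 * l - 2 - a - b = k})"
    by (simp only: card_R)
  finally show ?thesis .
qed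

section \<open>Residues modulo an odd number\<close>

text \<open>
  A fixed point \<open>x\<close> of negation satisfies \<open>2 * x = 0\<close> modulo \<open>q\<close>; this is where \<open>q\<close> has to be odd.
\<close>
lemma signed_colouring_residues:
  assumes "signed_ideal l N P" "0 < q" "odd q"
  shows "signed_colouring l N P {0..<int q} (\<lambda>x. (- x) mod int q) 0"
proof -
  interpret signed_ideal l N P by fact
  show ?thesis
  proof
    show "(- ((- x) mod int q)) mod int q = x" if "x \<in> {0..<int q}" for x
      using that by (simp add: mod_minus_eq)
    show "(- x) mod int q = x \<longleftrightarrow> x = 0" if "x \<in> {0..<int q}" for x
    proof
      assume "(- x) mod int q = x"
      then have "(x + x) mod int q = 0" by (metis add.left_inverse mod_0 mod_add_left_eq)
      then have "int q dvd 2 * x" by auto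
      then have "int q dvd x" using assms(3) by (simp add: coprime_dvd_mult_right_iff)
      then show "x = 0" using that zdvd_imp_le[of "int q" x] by force
    qed simp
  qed (use assms in auto)
qed

text \<open>
  Up to the encoding of vectors as functions both sides count the same points: \<open>z\<close> is not annihilated by
  \<open>\<epsilon>\<^sub>a - \<epsilon>\<^sub>b\<close> if its coordinates \<open>a\<close> and \<open>b\<close> differ, and not by \<open>\<epsilon>\<^sub>a + \<epsilon>\<^sub>b\<close> if the first is not the
  negative of the second.
\<close>
lemma chi_quasi_eq_card_colourings:
  assumes "I \<subseteq> pos_roots l" "is_coord_mat l I T"
    and "signed_colouring l (minus_row l I) (plus_row l I) {0..<int q} (\<lambda>x. (- x) mod int q) 0"
  shows "chi_quasi T q = card (signed_colouring.colourings l (minus_row l I) (plus_row l I) {0..<int q}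
    (\<lambda>x. (- x) mod int q) 0)"
proof -
  interpret signed_colouring l "minus_row l I" "plus_row l I" "{0..<int q}" "\<lambda>x. (- x) mod int q" 0
    by fact
  have T: "dim_row T = l" "set (cols T) = I" using assms(2) by (auto simp: is_coord_mat_def)
  let ?A = "{z \<in> carrier_vec (dim_row T). (\<forall>i < dim_row T. z $ i \<in> {0..<int q}) \<and>
     (\<forall>j < dim_col T. (transpose_mat T *\<^sub>v z) $ j mod int q \<noteq> 0)}"
  have avoid: "(\<forall>j < dim_col T. (transpose_mat T *\<^sub>v z) $ j mod int q \<noteq> 0) \<longleftrightarrow>
      (\<forall>a\<in>{0..<l}. (\<forall>b\<in>minus_row l I a. z $ a \<noteq> z $ b) \<and>
        (\<forall>b\<in>plus_row l I a. z $ a \<noteq> (- (z $ b)) mod int q))"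
    if z: "z \<in> carrier_vec l" "\<forall>i<l. z $ i \<in> {0..<int q}" for z
  proof -
    have "(\<forall>j < dim_col T. (transpose_mat T *\<^sub>v z) $ j mod int q \<noteq> 0) \<longleftrightarrow>
        (\<forall>\<beta>\<in>I. (\<beta> \<bullet> z) mod int q \<noteq> 0)"
      unfolding T(2)[symmetric] by (auto simp: cols_def mod_eq_0_iff_dvd)
    also have "\<dots> \<longleftrightarrow> (\<forall>a\<in>{0..<l}.
        (\<forall>b\<in>minus_row l I a. ((unit_vec l a - unit_vec l b) \<bullet> z) mod int q \<noteq> 0) \<and>
        (\<forall>b\<in>plus_row l I a. ((unit_vec l a + unit_vec l b) \<bullet> z) mod int q \<noteq> 0))"
      by (rule Ball_root_ideal[OF assms(1)])
    also have "\<dots> \<longleftrightarrow> (\<forall>a\<in>{0..<l}. (\<forall>b\<in>minus_row l I a. z $ a \<noteq> z $ b) \<and>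
        (\<forall>b\<in>plus_row l I a. z $ a \<noteq> (- (z $ b)) mod int q))"
    proof -
      have diff: "((unit_vec l a - unit_vec l b) \<bullet> z) mod int q = 0 \<longleftrightarrow> z $ a = z $ b"
        if "a < l" "b < l" for a b
      proof -
        have "(unit_vec l a - unit_vec l b) \<bullet> z = z $ a - z $ b"
          using z(1) that
          by (simp add: minus_scalar_prod_distrib[OF unit_vec_carrier unit_vec_carrier z(1)])
        moreover have "(z $ a - z $ b) mod int q = 0 \<longleftrightarrow> z $ a mod int q = z $ b mod int q"
          by (simp add: mod_eq_dvd_iff dvd_eq_mod_eq_0)
        ultimately show ?thesis using z(2) that by simp
      qed
      have sum: "((unit_vec l a + unit_vec l b) \<bullet> z) mod int q = 0 \<longleftrightarrow> z $ a = (- (z $ b)) mod int q"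
        if "a < l" "b < l" for a b
      proof -
        have "(unit_vec l a + unit_vec l b) \<bullet> z = z $ a + z $ b"
          using z(1) that
          by (simp add: add_scalar_prod_distrib[OF unit_vec_carrier unit_vec_carrier z(1)])
        moreover have "(z $ a + z $ b) mod int q = 0 \<longleftrightarrow> z $ a mod int q = (- (z $ b)) mod int q"
          by (simp add: mod_eq_dvd_iff dvd_eq_mod_eq_0)
        ultimately show ?thesis using z(2) that by simp
      qed
      show ?thesis using diff sum by (auto simp: minus_row_def plus_row_def)
    qed
    finally show ?thesis .
  qed
  have "bij_betw (\<lambda>f. vec l f) (colourings 0) ?A"
  proof (rule bij_betw_byWitness[where f' = "\<lambda>z. restrict (\<lambda>i. z $ i) {0..<l}"])
    show "\<forall>f\<in>colourings 0. restrict (\<lambda>i. vec l f $ i) {0..<l} = f"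
      by (auto simp: colourings_def PiE_iff extensional_def restrict_def fun_eq_iff)
    show "\<forall>z\<in>?A. vec l (restrict (\<lambda>i. z $ i) {0..<l}) = z"
      by (auto simp: T)
    show "vec l ` colourings 0 \<subseteq> ?A"
    proof
      fix z assume "z \<in> vec l ` colourings 0"
      then obtain f where f: "f \<in> colourings 0" "z = vec l f" by blast
      have z: "z \<in> carrier_vec l" "\<forall>i<l. z $ i \<in> {0..<int q}"
        using f by (auto simp: colourings_def PiE_iff)
      show "z \<in> ?A" unfolding T using z avoid[OF z] f
        by (auto simp: colourings_def minus_row_def plus_row_def)
    qed
    show "(\<lambda>z. restrict (\<lambda>i. z $ i) {0..<l}) ` ?A \<subseteq> colourings 0"
    proof
      fix f assume "f \<in> (\<lambda>z. restrict (\<lambda>i. z $ i) {0..<l}) ` ?A"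
      then obtain z where z: "z \<in> carrier_vec l" "\<forall>i<l. z $ i \<in> {0..<int q}"
        "\<forall>j < dim_col T. (transpose_mat T *\<^sub>v z) $ j mod int q \<noteq> 0"
        and f: "f = restrict (\<lambda>i. z $ i) {0..<l}"
        unfolding T by blast
      show "f \<in> colourings 0" using avoid[OF z(1,2)] z f
        by (auto simp: colourings_def minus_row_def plus_row_def)
    qed
  qed
  from bij_betw_same_card[OF this] show ?thesis unfolding chi_quasi_def by simp
qed

theorem theorem3p12:
  fixes l q :: nat and I :: "int vec set" and T :: "int mat" and d :: "nat list"
  assumes "3 \<le> l"
    and "root_ideal l I"
    and "mset d = mset (dual_partition l I)"
    and "is_coord_mat l I T"
    and "0 < q" and "odd q"
  shows "int (chi_quasi T q) = (\<Prod>i<l. int q - int (d ! i))"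
proof -
  have I: "I \<subseteq> pos_roots l" using assms(2) by (simp add: root_ideal_def)
  have rows: "signed_ideal l (minus_row l I) (plus_row l I)"
    using signed_ideal_rows assms(1,2) by simp
  note colouring = signed_colouring_residues[OF rows assms(5,6)]
  interpret signed_colouring l "minus_row l I" "plus_row l I" "{0..<int q}" "\<lambda>x. (- x) mod int q" 0
    by (rule colouring)
  have "\<forall>\<beta>\<in>I. 0 < ht l \<beta>"
    unfolding Ball_root_ideal[OF I] by (auto simp: minus_row_def plus_row_def ht_diff ht_sum)
  then have d: "mset d = exponents"
    using mset_dual_partition[OF finite_subset[OF I finite_pos_roots] _ size_exponents]
      ht_count_eq_sum_rows[OF I] heights_eq_exponent_tails assms(3) by simp
  then have "length d = l" using size_exponents by (metis size_mset)
  have "int (chi_quasi T q) = (\<Prod>x\<in>#mset d. int q - int x)"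
    using card_colourings chi_quasi_eq_card_colourings[OF I assms(4) colouring] d by simp
  also have "\<dots> = prod_list (map (\<lambda>x. int q - int x) d)"
    by (simp only: prod_mset_prod_list flip: mset_map)
  also have "\<dots> = (\<Prod>i<l. int q - int (d ! i))"
    using \<open>length d = l\<close> by (simp add: prod.list_conv_set_nth atLeast0LessThan)
  finally show ?thesis .
qed

end
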